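(* Let $k$ be a field and let $\mathfrak{g}\subseteq\mathfrak{h}$ be an extension of Lie algebras over $k$ such that $\dim_k(\mathfrak{g})=n$ and $\dim_k(\mathfrak{h})=n+m$. Then the Galois group $\mathrm{Gal}(\mathfrak{h}/\mathfrak{g})$ embeds, as a group, in the canonical semidirect product of groups $\mathrm{GL}(m,k)\rtimes \mathrm{M}_{n\times m}(k)$.
   Context: An extension $\mathfrak{g}\subseteq\mathfrak{h}$ of Lie algebras means that $\mathfrak{g}$ is a Lie subalgebra of $\mathfrak{h}$. The Galois group is $\mathrm{Gal}(\mathfrak{h}/\mathfrak{g}) := \{\sigma\in \mathrm{Aut}_{\mathrm{Lie}}(\mathfrak{h}) \mid \sigma(g)=g \text{ for all } g\in\mathfrak{g}\}$, a group under composition. $\mathrm{GL}(m,k)$ is the group of invertible $m\times m$ matrices over $k$ and $\mathrm{M}_{n\times m}(k)$ is the additive group of $n\times m$ matrices over $k$. The canonical semidirect product $\mathrm{GL}(m,k)\rtimes \mathrm{M}_{n\times m}(k)$ is the set $\mathrm{GL}(m,k)\times \mathrm{M}_{n\times m}(k)$ with multiplication $(A,R)\cdot(A',R') := (AA',\, RA'+R')$; it is the matrix form of the semidirect product $\mathrm{GL}_k(V)\rtimes\mathrm{Hom}_k(V,W)$ (with $\dim V=m$, $\dim W=n$) associated to the right action $r\triangleleft\sigma = r\circ\sigma$. *)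

theory Defs
  imports "HOL-Algebra.Group" "Jordan_Normal_Form.Matrix"
begin

text \<open>
  The scalars are a type of class \<^class>\<open>field\<close> and the ambient Lie algebra is a whole type. The bracket
  is alternating, not merely antisymmetric, so that characteristic 2 is treated correctly.
\<close>

locale lie_algebra = vector_space scale
  for scale :: "'k::field \<Rightarrow> 'h::ab_group_add \<Rightarrow> 'h" +
  fixes bracket :: "'h \<Rightarrow> 'h \<Rightarrow> 'h"
  assumes linear_bracket_left: "Vector_Spaces.linear scale scale (\<lambda>x. bracket x y)"
    and linear_bracket_right: "Vector_Spaces.linear scale scale (\<lambda>y. bracket x y)"
    and bracket_self: "bracket x x = 0"
    and jacobi: "bracket x (bracket y z) + bracket y (bracket z x) + bracket z (bracket x y) = 0"
begin

definition lie_subalgebra :: "'h set \<Rightarrow> bool" where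
  "lie_subalgebra \<gg> \<longleftrightarrow> subspace \<gg> \<and> (\<forall>x\<in>\<gg>. \<forall>y\<in>\<gg>. bracket x y \<in> \<gg>)"

definition lie_automorphisms :: "('h \<Rightarrow> 'h) set" where
  "lie_automorphisms = {\<sigma>. Vector_Spaces.linear scale scale \<sigma> \<and> bij \<sigma> \<and>
     (\<forall>x y. \<sigma> (bracket x y) = bracket (\<sigma> x) (\<sigma> y))}"

definition galois_group :: "'h set \<Rightarrow> ('h \<Rightarrow> 'h) monoid" where
  "galois_group \<gg> = \<lparr>carrier = {\<sigma> \<in> lie_automorphisms. \<forall>x\<in>\<gg>. \<sigma> x = x}, mult = (\<circ>), one = id\<rparr>"

end

text \<open>
  The library's \<^term>\<open>vector_space.dim\<close> is 0 on infinite-dimensional spaces, so finite-dimensionality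
  has to be required separately.
\<close>

definition (in vector_space) has_dimension :: "'b set \<Rightarrow> nat \<Rightarrow> bool" where
  "has_dimension V n \<longleftrightarrow> (\<exists>B. finite B \<and> V \<subseteq> span B) \<and> dim V = n"

definition GL :: "nat \<Rightarrow> 'k::field mat monoid" where
  "GL m = units_of (ring_mat TYPE('k) m ())"

definition GL_semidirect_M :: "nat \<Rightarrow> nat \<Rightarrow> ('k::field mat \<times> 'k mat) monoid" where
  "GL_semidirect_M m n =
     \<lparr>carrier = carrier (GL m) \<times> carrier_mat n m,
      mult = (\<lambda>(A, R) (A', R'). (A * A', R * A' + R')),
      one = (1\<^sub>m m, 0\<^sub>m n m)\<rparr>"

end

theory Submission
  imports Defs
begin

text \<open>
  Extend a basis of the subalgebra to a basis of the ambient algebra. In it, an automorphism fixing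
  the subalgebra pointwise has a block matrix with rows \<open>(1, R)\<close> and \<open>(0, A)\<close>, and multiplying two
  such matrices gives \<open>(A, R) (A', R') = (A A', R A' + R')\<close>.
\<close>

context vector_space
begin

text \<open>A basis of \<open>V\<close> extends to a basis of the whole space. Numbering the part in
  \<open>V\<close> first turns the block structure into a condition on indices, and the dual
  coordinate functionals \<open>c\<close> let matrix entries be read off without further reference
  to bases as sets.\<close>

lemma adapted_basis_exists:
  assumes "has_dimension V n" and "has_dimension UNIV (n + m)"
  obtains b c where "\<And>i. i < n \<Longrightarrow> b i \<in> V"
    and "\<And>i. Vector_Spaces.linear scale (*) (c i)"
    and "\<And>i j. i < n + m \<Longrightarrow> j < n + m \<Longrightarrow> c i (b j) = (if i = j then 1 else 0)"
    and "\<And>x. (\<Sum>i<n + m. scale (c i x) (b i)) = x"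
proof -
  obtain S where S: "finite S" "UNIV \<subseteq> span S"
    using assms(2) unfolding has_dimension_def by (elim conjE exE)
  obtain B where B: "B \<subseteq> V" "independent B" "V \<subseteq> span B" "card B = dim V"
    by (rule basis_exists)
  obtain C where C: "B \<subseteq> C" "independent C" "UNIV \<subseteq> span C"
    using maximal_independent_subset_extend[OF subset_UNIV B(2)] by metis
  \<comment> \<open>This uses the finite spanning set in \<open>has_dimension\<close>: an
    independent set is no larger than a finite spanning one.\<close>
  have finC: "finite C"
    using independent_span_bound[OF S(1) C(2)] S(2) by (meson subset_trans subset_UNIV)
  have cardB: "card B = n" and cardC: "card C = n + m"
    using B(4) basis_card_eq_dim[OF _ C(3) C(2)] assms by (auto simp: has_dimension_def)
  have finB: "finite B" using C(1) finC by (rule finite_subset)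
  have cardD: "card (C - B) = m"
    using card_Diff_subset[OF finB C(1)] cardB cardC by simp
  obtain f where f: "bij_betw f {..<n} B"
    using ex_bij_betw_nat_finite[OF finB] cardB by (auto simp: lessThan_atLeast0)
  obtain g where g: "bij_betw g {..<m} (C - B)"
    using ex_bij_betw_nat_finite[of "C - B"] finC cardD by (auto simp: lessThan_atLeast0)
  \<comment> \<open>The indices below \<open>n\<close> enumerate \<open>B\<close>; the remaining
    ones, shifted down by \<open>n\<close>, enumerate the complement \<open>C - B\<close>.\<close>
  define b where "b i = (if i < n then f i else g (i - n))" for i
  have "bij_betw (\<lambda>i. i - n) {n..<n + m} {..<m}"
    by (rule bij_betwI[where g = "\<lambda>i. i + n"]) auto
  then have "bij_betw (g \<circ> (\<lambda>i. i - n)) {n..<n + m} (C - B)"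
    using g by (rule bij_betw_trans)
  moreover have "bij_betw b {n..<n + m} (C - B) \<longleftrightarrow> bij_betw (g \<circ> (\<lambda>i. i - n)) {n..<n + m} (C - B)"
    by (intro bij_betw_cong) (simp add: b_def)
  moreover have "bij_betw b {..<n} B \<longleftrightarrow> bij_betw f {..<n} B"
    by (intro bij_betw_cong) (simp add: b_def)
  ultimately have "bij_betw b ({..<n} \<union> {n..<n + m}) (B \<union> (C - B))"
    using f by (intro bij_betw_combine) auto
  moreover have "{..<n} \<union> {n..<n + m} = {..<n + m}" "B \<union> (C - B) = C"
    using C(1) by auto
  ultimately have b: "bij_betw b {..<n + m} C" by simp
  \<comment> \<open>For fixed \<open>i\<close> this is linear in \<open>x\<close> even when
    \<open>i\<close> is out of range, because \<open>representation\<close> is linear in its vector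
    argument whichever vector \<open>b i\<close> is.\<close>
  define c where "c i x = representation C x (b i)" for i x
  show ?thesis
  proof
    show "b i \<in> V" if "i < n" for i
      using that f B(1) by (auto simp: b_def dest: bij_betwE)
    show "Vector_Spaces.linear scale (*) (c i)" for i
      using linear_representation[OF C(2)] C(3) by (simp add: c_def[abs_def] top.extremum_unique)
    show "c i (b j) = (if i = j then 1 else 0)" if "i < n + m" "j < n + m" for i j
    proof -
      have "b j \<in> C" using that(2) bij_betwE[OF b] by blast
      moreover have "b i = b j \<longleftrightarrow> i = j"
        using that inj_on_eq_iff[OF bij_betw_imp_inj_on[OF b]] by blast
      ultimately show ?thesis by (simp add: c_def representation_basis[OF C(2)])
    qed
    show "(\<Sum>i<n + m. scale (c i x) (b i)) = x" for x
      unfolding c_def sum.reindex_bij_betw[OF b, of "\<lambda>y. scale (representation C x y) y"]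
      by (rule sum_representation_eq) (use C finC in auto)
  qed
qed

end

context lie_algebra
begin

text \<open>Composition supplies associativity and the unit; the point is that linearity,
  compatibility with the bracket and fixing \<open>\<gg>\<close> pointwise all pass to the inverse
  map.\<close>

lemma galois_group_group: "group (galois_group \<gg>)"
proof (rule groupI)
  fix \<sigma> assume \<sigma>: "\<sigma> \<in> carrier (galois_group \<gg>)"
  then have lin: "Vector_Spaces.linear scale scale \<sigma>" and bij: "bij \<sigma>"
    and br: "\<And>x y. \<sigma> (bracket x y) = bracket (\<sigma> x) (\<sigma> y)" and fixed: "\<And>x. x \<in> \<gg> \<Longrightarrow> \<sigma> x = x"
    by (auto simp: galois_group_def lie_automorphisms_def)
  have cancel: "inv_into UNIV \<sigma> (\<sigma> x) = x" "\<sigma> (inv_into UNIV \<sigma> x) = x" for x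
    using bij by (simp_all add: bij_is_inj bij_is_surj surj_f_inv_f)
  have "Vector_Spaces.linear scale scale (inv_into UNIV \<sigma>)"
    using bij_module_hom_imp_inv_module_hom lin bij
    by (simp add: linear_iff_module_hom)
  \<comment> \<open>Write \<open>x\<close> and \<open>y\<close> as images under
    \<open>\<sigma>\<close>, and apply \<open>br\<close> to their preimages.\<close>
  moreover have "inv_into UNIV \<sigma> (bracket x y) = bracket (inv_into UNIV \<sigma> x) (inv_into UNIV \<sigma> y)" for x y
    by (metis br cancel)
  moreover have "inv_into UNIV \<sigma> x = x" if "x \<in> \<gg>" for x
    using fixed[OF that] cancel(1)[of x] by simp
  ultimately have "inv_into UNIV \<sigma> \<in> carrier (galois_group \<gg>)"
    using bij by (simp add: galois_group_def lie_automorphisms_def bij_imp_bij_inv)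
  moreover have "inv_into UNIV \<sigma> \<otimes>\<^bsub>galois_group \<gg>\<^esub> \<sigma> = \<one>\<^bsub>galois_group \<gg>\<^esub>"
    by (auto simp: galois_group_def cancel)
  ultimately show "\<exists>\<tau>\<in>carrier (galois_group \<gg>). \<tau> \<otimes>\<^bsub>galois_group \<gg>\<^esub> \<sigma> = \<one>\<^bsub>galois_group \<gg>\<^esub>"
    by blast
qed (auto simp: galois_group_def lie_automorphisms_def bij_comp Vector_Spaces.linear_compose
    linear_id o_assoc)

end

lemma GL_group: "group (GL m :: 'k::field mat monoid)"
proof -
  interpret semiring "ring_mat TYPE('k) m ()" by (rule semiring_mat)
  show ?thesis unfolding GL_def by (rule units_group)
qed

lemma GL_simps:
  "(\<otimes>\<^bsub>GL m\<^esub>) = (*)" "\<one>\<^bsub>GL m\<^esub> = 1\<^sub>m m"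
  by (simp_all add: GL_def units_of_mult units_of_one ring_mat_simps)

lemma carrier_GL_iff:
  "A \<in> carrier (GL m) \<longleftrightarrow>
    A \<in> carrier_mat m m \<and> (\<exists>B\<in>carrier_mat m m. B * A = 1\<^sub>m m \<and> A * B = 1\<^sub>m m)"
  by (auto simp: GL_def units_of_carrier Units_def ring_mat_simps)

text \<open>Associativity reduces to distributivity of matrix multiplication. The left inverse of
  \<open>(A, R)\<close> is \<open>(B, - (R * B))\<close> with \<open>B\<close> the inverse of
  \<open>A\<close>.\<close>

lemma GL_semidirect_M_group:
  "group (GL_semidirect_M m n :: ('k::field mat \<times> 'k mat) monoid)" (is "group ?S")
proof (rule groupI)
  interpret GL: group "GL m :: 'k mat monoid" by (rule GL_group)
  note GL_closed = GL.m_closed[unfolded GL_simps] GL.one_closed[unfolded GL_simps]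
  have dims: "A \<in> carrier_mat m m" if "A \<in> carrier (GL m)" for A :: "'k mat"
    using that by (simp add: carrier_GL_iff)
  show "x \<otimes>\<^bsub>?S\<^esub> y \<in> carrier ?S" if "x \<in> carrier ?S" "y \<in> carrier ?S" for x y
    using that by (auto simp: GL_semidirect_M_def GL_closed dims intro!: add_carrier_mat mult_carrier_mat)
  show "\<one>\<^bsub>?S\<^esub> \<in> carrier ?S"
    by (simp add: GL_semidirect_M_def GL_closed)
  show "(x \<otimes>\<^bsub>?S\<^esub> y) \<otimes>\<^bsub>?S\<^esub> z = x \<otimes>\<^bsub>?S\<^esub> (y \<otimes>\<^bsub>?S\<^esub> z)"
    if carr: "x \<in> carrier ?S" "y \<in> carrier ?S" "z \<in> carrier ?S" for x y z
  proof -
    obtain A R A' R' A'' R'' where eq: "x = (A, R)" "y = (A', R')" "z = (A'', R'')"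
      by (metis surj_pair)
    have mem: "A \<in> carrier_mat m m" "A' \<in> carrier_mat m m" "A'' \<in> carrier_mat m m"
      "R \<in> carrier_mat n m" "R' \<in> carrier_mat n m" "R'' \<in> carrier_mat n m"
      using carr dims by (auto simp: GL_semidirect_M_def eq)
    have "(R * A' + R') * A'' + R'' = R * A' * A'' + R' * A'' + R''"
      using mem by (subst add_mult_distrib_mat) auto
    also have "\<dots> = R * (A' * A'') + (R' * A'' + R'')"
      using mem assoc_mult_mat[OF mem(4,2,3)]
        assoc_add_mat[of "R * (A' * A'')" n m "R' * A''" R''] by simp
    finally show ?thesis
      using mem by (auto simp: GL_semidirect_M_def eq)
  qed
  show "\<one>\<^bsub>?S\<^esub> \<otimes>\<^bsub>?S\<^esub> x = x" if "x \<in> carrier ?S" for x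
    using that by (auto simp: GL_semidirect_M_def dest!: dims)
  show "\<exists>y\<in>carrier ?S. y \<otimes>\<^bsub>?S\<^esub> x = \<one>\<^bsub>?S\<^esub>" if carr: "x \<in> carrier ?S" for x
  proof -
    obtain A R where x: "x = (A, R)" "A \<in> carrier (GL m)" "R \<in> carrier_mat n m"
      using carr by (auto simp: GL_semidirect_M_def)
    obtain B where B: "B \<in> carrier (GL m)" "B * A = 1\<^sub>m m"
      using GL.l_inv_ex[OF x(2)] by (auto simp: GL_simps)
    have mem: "A \<in> carrier_mat m m" "B \<in> carrier_mat m m"
      using dims x(2) B(1) by auto
    \<comment> \<open>The second component of the inverse has to solve \<open>X * A + R = 0\<close>,
      whence \<open>X = - (R * B)\<close>.\<close>
    have "- (R * B) * A + R = 0\<^sub>m n m"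
      using mem x(3) B(2) by (simp add: uminus_l_inv_mat)
    then show ?thesis
      using mem x B by (intro bexI[of _ "(B, - (R * B))"]) (auto simp: GL_semidirect_M_def)
  qed
qed

theorem corollary3p3:
  fixes scale :: "'k::field \<Rightarrow> 'h::ab_group_add \<Rightarrow> 'h"
    and bracket :: "'h \<Rightarrow> 'h \<Rightarrow> 'h"
    and \<gg> :: "'h set"
    and n m :: nat
  assumes "lie_algebra scale bracket"
    and "lie_algebra.lie_subalgebra scale bracket \<gg>"
    and "vector_space.has_dimension scale \<gg> n"
    and "vector_space.has_dimension scale (UNIV :: 'h set) (n + m)"
  shows "\<exists>\<phi>. group_hom (lie_algebra.galois_group scale bracket \<gg>)
                  (GL_semidirect_M m n :: ('k mat \<times> 'k mat) monoid) \<phi> \<and>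
             inj_on \<phi> (carrier (lie_algebra.galois_group scale bracket \<gg>))"
proof -
  interpret lie_algebra scale bracket by fact
  obtain b c where b: "\<And>i. i < n \<Longrightarrow> b i \<in> \<gg>"
    and c_lin: "\<And>i. Vector_Spaces.linear scale (*) (c i)"
    and c_b: "\<And>i j. i < n + m \<Longrightarrow> j < n + m \<Longrightarrow> c i (b j) = (if i = j then 1 else 0)"
    and c_sum: "\<And>x. (\<Sum>i<n + m. scale (c i x) (b i)) = x"
    using adapted_basis_exists[OF assms(3,4)] by blast
  let ?G = "galois_group \<gg>" and ?S = "GL_semidirect_M m n :: ('k mat \<times> 'k mat) monoid"
  interpret G: group ?G by (rule galois_group_group)
  \<comment> \<open>\<open>A\<close> and \<open>R\<close> are the lower right and upper right blocks
    of the matrix of \<open>\<sigma>\<close>, with images of basis vectors as columns, so that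
    composition corresponds to the matrix product in the same order.\<close>
  define A where "A \<sigma> = mat m m (\<lambda>(i, j). c (n + i) (\<sigma> (b (n + j))))" for \<sigma>
  define R where "R \<sigma> = mat n m (\<lambda>(i, j). c i (\<sigma> (b (n + j))))" for \<sigma>
  have A_carrier: "A \<sigma> \<in> carrier_mat m m" and R_carrier: "R \<sigma> \<in> carrier_mat n m" for \<sigma>
    by (simp_all add: A_def R_def)
  have lin: "Vector_Spaces.linear scale scale \<sigma>" if "\<sigma> \<in> carrier ?G" for \<sigma>
    using that by (simp add: galois_group_def lie_automorphisms_def)
  have fixes_b: "\<sigma> (b i) = b i" if "\<sigma> \<in> carrier ?G" "i < n" for \<sigma> i
    using that b by (simp add: galois_group_def)
  have expand: "\<sigma> x = (\<Sum>l<n + m. scale (c l x) (\<sigma> (b l)))" if "\<sigma> \<in> carrier ?G" for \<sigma> x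
  proof -
    interpret \<sigma>: Vector_Spaces.linear scale scale \<sigma> by (rule lin[OF that])
    have "\<sigma> x = \<sigma> (\<Sum>l<n + m. scale (c l x) (b l))"
      by (simp only: c_sum)
    then show ?thesis
      by (simp only: \<sigma>.sum \<sigma>.scale)
  qed
  have split: "(\<Sum>l<n + m. f l) = (\<Sum>l<n. f l) + (\<Sum>l<m. f (n + l))" for f :: "nat \<Rightarrow> 'k"
  proof (induction m)
  qed (simp_all add: add.assoc)
  \<comment> \<open>This is row \<open>i\<close> of \<open>\<sigma>\<close> times column
    \<open>n + j\<close> of \<open>\<tau>\<close>. The first \<open>n\<close> columns of
    \<open>\<sigma>\<close> are unit vectors, so that part of the sum keeps at most the term with
    \<open>l = i\<close>. Rows from \<open>n\<close> on give the rule for \<open>A\<close>, rows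
    below \<open>n\<close> the rule for \<open>R\<close>.\<close>
  have c_comp: "c i ((\<sigma> \<circ> \<tau>) (b (n + j))) =
      (\<Sum>l<m. c i (\<sigma> (b (n + l))) * c (n + l) (\<tau> (b (n + j)))) +
      (if i < n then c i (\<tau> (b (n + j))) else 0)"
    if "\<sigma> \<in> carrier ?G" "i < n + m" for \<sigma> \<tau> i j
  proof -
    interpret c: Vector_Spaces.linear scale "(*)" "c i" by (rule c_lin)
    let ?x = "\<tau> (b (n + j))"
    have "c i (\<sigma> ?x) = (\<Sum>l<n + m. c l ?x * c i (\<sigma> (b l)))"
      by (simp only: expand[OF that(1), of ?x] c.sum c.scale)
    also have "\<dots> = (\<Sum>l<n. c l ?x * (if i = l then 1 else 0)) + (\<Sum>l<m. c (n + l) ?x * c i (\<sigma> (b (n + l))))"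
      unfolding split using that by (auto simp: fixes_b[OF that(1)] c_b intro!: sum.cong)
    also have "(\<Sum>l<n. c l ?x * (if i = l then 1 else 0)) = (if i < n then c i ?x else 0)"
      by (simp add: if_distrib cong: if_cong)
    finally show ?thesis by (simp add: mult.commute add.commute)
  qed
  \<comment> \<open>Deleting \<open>o_apply\<close> keeps the composite folded, so that
    \<open>c_comp\<close> can match it.\<close>
  have A_comp: "A (\<sigma> \<circ> \<tau>) = A \<sigma> * A \<tau>" if "\<sigma> \<in> carrier ?G" for \<sigma> \<tau>
    by (rule eq_matI)
      (auto simp: A_def scalar_prod_def lessThan_atLeast0 c_comp[OF that] simp del: o_apply)
  have R_comp: "R (\<sigma> \<circ> \<tau>) = R \<sigma> * A \<tau> + R \<tau>" if "\<sigma> \<in> carrier ?G" for \<sigma> \<tau>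
    by (rule eq_matI)
      (auto simp: A_def R_def scalar_prod_def lessThan_atLeast0 c_comp[OF that] simp del: o_apply)
  have A_id: "A id = 1\<^sub>m m"
    by (rule eq_matI) (auto simp: A_def c_b)
  \<comment> \<open>Invertibility follows from multiplicativity: the inverse matrix is the block
    \<open>A\<close> of the inverse automorphism.\<close>
  have A_GL: "A \<sigma> \<in> carrier (GL m)" if "\<sigma> \<in> carrier ?G" for \<sigma>
  proof -
    have inv: "inv\<^bsub>?G\<^esub> \<sigma> \<in> carrier ?G" "inv\<^bsub>?G\<^esub> \<sigma> \<circ> \<sigma> = id" "\<sigma> \<circ> inv\<^bsub>?G\<^esub> \<sigma> = id"
      using that G.inv_closed[OF that] G.l_inv[OF that] G.r_inv[OF that]
      by (simp_all add: galois_group_def)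
    have "A (inv\<^bsub>?G\<^esub> \<sigma>) * A \<sigma> = 1\<^sub>m m" "A \<sigma> * A (inv\<^bsub>?G\<^esub> \<sigma>) = 1\<^sub>m m"
      using A_comp[OF inv(1), of \<sigma>] A_comp[OF that, of "inv\<^bsub>?G\<^esub> \<sigma>"] inv A_id by simp_all
    then show ?thesis
      using A_carrier by (auto simp: carrier_GL_iff)
  qed
  let ?\<phi> = "\<lambda>\<sigma>. (A \<sigma>, R \<sigma>)"
  have "?\<phi> \<in> hom ?G ?S"
  proof (rule homI)
    show "?\<phi> \<sigma> \<in> carrier ?S" if "\<sigma> \<in> carrier ?G" for \<sigma>
      using A_GL[OF that] R_carrier by (simp add: GL_semidirect_M_def)
    show "?\<phi> (\<sigma> \<otimes>\<^bsub>?G\<^esub> \<tau>) = ?\<phi> \<sigma> \<otimes>\<^bsub>?S\<^esub> ?\<phi> \<tau>" if "\<sigma> \<in> carrier ?G" for \<sigma> \<tau>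
      using A_comp[OF that] R_comp[OF that] by (simp add: galois_group_def GL_semidirect_M_def)
  qed
  then have "group_hom ?G ?S ?\<phi>"
    using GL_semidirect_M_group G.is_group by (simp add: group_hom_def group_hom_axioms_def)
  moreover have "inj_on ?\<phi> (carrier ?G)"
  proof (rule inj_onI, rule ext)
    fix \<sigma> \<tau> x assume \<sigma>: "\<sigma> \<in> carrier ?G" and \<tau>: "\<tau> \<in> carrier ?G" and eq: "?\<phi> \<sigma> = ?\<phi> \<tau>"
    \<comment> \<open>Stacked on top of each other, \<open>R\<close> and \<open>A\<close> contain
      every coordinate of the image of \<open>b (n + j)\<close>.\<close>
    have coords: "c i (\<sigma> (b (n + j))) = c i (\<tau> (b (n + j)))" if "i < n + m" "j < m" for i j
    proof (cases "i < n")
      case True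
      have "R \<sigma> $$ (i, j) = R \<tau> $$ (i, j)" using eq by simp
      then show ?thesis using True that by (simp add: R_def)
    next
      case False
      have "A \<sigma> $$ (i - n, j) = A \<tau> $$ (i - n, j)" using eq by simp
      then show ?thesis using False that by (simp add: A_def)
    qed
    \<comment> \<open>Both maps fix the first \<open>n\<close> basis vectors; on the others their
      values have equal coordinates and are rebuilt from them by \<open>c_sum\<close>.\<close>
    have "\<sigma> (b l) = \<tau> (b l)" if l: "l < n + m" for l
    proof (cases "l < n")
      case True
      then show ?thesis using fixes_b[OF \<sigma>] fixes_b[OF \<tau>] by simp
    next
      case False
      then obtain j where j: "l = n + j" "j < m"
        using l by (metis add_less_cancel_left le_Suc_ex not_less)
      have "(\<Sum>i<n + m. scale (c i (\<sigma> (b l))) (b i)) = (\<Sum>i<n + m. scale (c i (\<tau> (b l))) (b i))"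
        unfolding j(1) using coords[OF _ j(2)] by simp
      then show ?thesis by (simp only: c_sum)
    qed
    then show "\<sigma> x = \<tau> x"
      unfolding expand[OF \<sigma>, of x] expand[OF \<tau>, of x] by (intro sum.cong) auto
  qed
  ultimately show ?thesis by blast
qed

end
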